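(* Let $\mathcal{C}$ be a robust hereditary graph class for which $\beta_{\mathcal{C}}$ is finite. For every integer $d\ge 1$, $$\beta_{\mathcal{C}}(d)=\begin{cases}2^{d-1}+1 & \text{if } \beta_{\mathcal{C}}=1,\\ (\beta_{\mathcal{C}}-1)\,2^{d}+1 & \text{if } \beta_{\mathcal{C}}\ge 2.\end{cases}$$ In particular, the maximum size of a minimal blocking set in a graph of treedepth at most $d$ is $1$ for $d=1$ and $2^{d-2}+1$ for $d\ge2$.
   Context: All graphs are finite, simple, undirected. $\mathrm{OPT}(G)$ is the minimum vertex cover size. $Y\subseteq V(G)$ is a blocking set of $G$ if no vertex cover of $G$ of size $\mathrm{OPT}(G)$ contains $Y$; minimal if no proper subset is a blocking set. $\beta(G)$ is the maximum size of a minimal blocking set of $G$; for a class $\mathcal{C}$, $\beta_{\mathcal{C}}=\sup_{G\in\mathcal{C}}\beta(G)$. Elimination distance of $G$ to $\mathcal{C}$: $\mathrm{ed}_{\mathcal{C}}(G)=0$ if $G\in\mathcal{C}$; otherwise, if $G$ is connected, $\mathrm{ed}_{\mathcal{C}}(G)=1+\min_{v\in V(G)}\mathrm{ed}_{\mathcal{C}}(G-v)$; otherwise it is the maximum of $\mathrm{ed}_{\mathcal{C}}$ over the connected components of $G$. $\beta_{\mathcal{C}}(d)=\max\{\beta(G): \mathrm{ed}_{\mathcal{C}}(G)\le d\}$. Treedepth is the elimination distance to the class consisting of the empty graph. A class is hereditary if closed under taking induced subgraphs, and robust if a graph is in it iff all its connected components are. *)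

theory Defs
  imports "HOL-Library.Extended_Nat"
begin

text \<open>Finite simple graphs with vertices drawn from nat: a pair (V, E) where E is a
set of 2-element subsets of V.  Every finite simple graph is isomorphic to one of these.\<close>

type_synonym graph = "nat set \<times> nat set set"

definition verts :: "graph \<Rightarrow> nat set" where "verts G = fst G"
definition edges :: "graph \<Rightarrow> nat set set" where "edges G = snd G"

definition wf_graph :: "graph \<Rightarrow> bool" where
  "wf_graph G \<longleftrightarrow> finite (verts G) \<and>
     (\<forall>e\<in>edges G. \<exists>u v. u \<noteq> v \<and> e = {u, v} \<and> u \<in> verts G \<and> v \<in> verts G)"

definition induced :: "graph \<Rightarrow> nat set \<Rightarrow> graph" where
  "induced G S = (S, {e \<in> edges G. e \<subseteq> S})"

definition del_vertex :: "graph \<Rightarrow> nat \<Rightarrow> graph" where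
  "del_vertex G v = induced G (verts G - {v})"

definition adj :: "graph \<Rightarrow> nat \<Rightarrow> nat \<Rightarrow> bool" where
  "adj G u v \<longleftrightarrow> {u, v} \<in> edges G \<and> u \<noteq> v"

definition reach :: "graph \<Rightarrow> nat \<Rightarrow> nat \<Rightarrow> bool" where
  "reach G = (adj G)\<^sup>*\<^sup>*"

definition connected_graph :: "graph \<Rightarrow> bool" where
  "connected_graph G \<longleftrightarrow> verts G \<noteq> {} \<and> (\<forall>u\<in>verts G. \<forall>v\<in>verts G. reach G u v)"

definition components :: "graph \<Rightarrow> graph set" where
  "components G = {induced G {w \<in> verts G. reach G v w} | v. v \<in> verts G}"

definition vertex_cover :: "graph \<Rightarrow> nat set \<Rightarrow> bool" where
  "vertex_cover G X \<longleftrightarrow> X \<subseteq> verts G \<and> (\<forall>e\<in>edges G. e \<inter> X \<noteq> {})"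

definition OPT :: "graph \<Rightarrow> nat" where
  "OPT G = (LEAST k. \<exists>X. vertex_cover G X \<and> card X = k)"

definition min_vertex_cover :: "graph \<Rightarrow> nat set \<Rightarrow> bool" where
  "min_vertex_cover G X \<longleftrightarrow> vertex_cover G X \<and> card X = OPT G"

definition blocking_set :: "graph \<Rightarrow> nat set \<Rightarrow> bool" where
  "blocking_set G Y \<longleftrightarrow> Y \<subseteq> verts G \<and> \<not> (\<exists>X. min_vertex_cover G X \<and> Y \<subseteq> X)"

definition minimal_blocking_set :: "graph \<Rightarrow> nat set \<Rightarrow> bool" where
  "minimal_blocking_set G Y \<longleftrightarrow> blocking_set G Y \<and> (\<forall>Z. Z \<subset> Y \<longrightarrow> \<not> blocking_set G Z)"

text \<open>beta(G): maximum size of a minimal blocking set (0 if there is none, i.e. for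
the graph without vertices).\<close>
definition beta :: "graph \<Rightarrow> nat" where
  "beta G = Max ({card Y | Y. minimal_blocking_set G Y} \<union> {0})"

definition map_graph :: "(nat \<Rightarrow> nat) \<Rightarrow> graph \<Rightarrow> graph" where
  "map_graph f G = (f ` verts G, (\<lambda>e. f ` e) ` edges G)"

definition graph_class :: "graph set \<Rightarrow> bool" where
  "graph_class C \<longleftrightarrow> (\<forall>G\<in>C. wf_graph G) \<and>
     (\<forall>G\<in>C. \<forall>f. inj_on f (verts G) \<longrightarrow> map_graph f G \<in> C)"

definition hereditary :: "graph set \<Rightarrow> bool" where
  "hereditary C \<longleftrightarrow> (\<forall>G\<in>C. \<forall>S. S \<subseteq> verts G \<longrightarrow> induced G S \<in> C)"

definition robust :: "graph set \<Rightarrow> bool" where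
  "robust C \<longleftrightarrow> (\<forall>G. wf_graph G \<longrightarrow> (G \<in> C \<longleftrightarrow> (\<forall>H\<in>components G. H \<in> C)))"

definition beta_class :: "graph set \<Rightarrow> enat" where
  "beta_class C = (SUP G\<in>C. enat (beta G))"

text \<open>Elimination distance: ed_le C G k means ed_C(G) \<le> k.  This is the
inductive unfolding of the recursive definition: ed_C(G) = 0 if G \<in> C; for connected
G \<notin> C it is 1 + min_v ed_C(G - v); otherwise the max over the components.\<close>
inductive ed_le :: "graph set \<Rightarrow> graph \<Rightarrow> nat \<Rightarrow> bool" for C where
  in_class: "G \<in> C \<Longrightarrow> ed_le C G k"
| conn: "connected_graph G \<Longrightarrow> v \<in> verts G \<Longrightarrow> ed_le C (del_vertex G v) k \<Longrightarrow> ed_le C G (Suc k)"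
| disconn: "\<not> connected_graph G \<Longrightarrow> (\<forall>H\<in>components G. ed_le C H k) \<Longrightarrow> ed_le C G k"

definition elim_dist :: "graph set \<Rightarrow> graph \<Rightarrow> nat" where
  "elim_dist C G = (LEAST k. ed_le C G k)"

definition beta_class_d :: "graph set \<Rightarrow> nat \<Rightarrow> enat" where
  "beta_class_d C d = (SUP G\<in>{G. wf_graph G \<and> elim_dist C G \<le> d}. enat (beta G))"

text \<open>Treedepth: elimination distance to the class consisting of the empty graph.\<close>
definition empty_graph_class :: "graph set" where
  "empty_graph_class = {G. wf_graph G \<and> verts G = {}}"

end

theory Submission
  imports Defs
begin

text \<open>Let \<open>f(S)\<close> be the minimum size of a vertex cover of \<open>G - v\<close> containing \<open>S\<close>, minus
\<open>OPT(G - v)\<close>; adding a vertex to \<open>S\<close> raises \<open>f\<close> by at most one. The interesting case is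
\<open>f(N(v)) = 1\<close>, in which \<open>Y\<close> avoiding \<open>v\<close> is blocking in \<open>G\<close> iff \<open>f(Y) \<ge> 1\<close> and
\<open>f(Y \<union> N(v)) \<ge> 2\<close>. If all minimal blocking sets of induced subgraphs of \<open>G - v\<close> have at most
\<open>b\<close> elements, each unit increase of \<open>f\<close> is achieved by at most \<open>b\<close> vertices, so \<open>2 b\<close> vertices
suffice; as a minimal such \<open>Y\<close> larger than \<open>b\<close> has \<open>f(Y) = 1\<close>, one of these vertices can be charged
to \<open>N(v)\<close>, which leaves \<open>2 b - 1\<close>. Blocking sets containing \<open>v\<close> have at most \<open>b + 1\<close> elements.
Conversely, joining a new vertex to a minimal blocking set of one graph and to one vertex of a minimal
blocking set of a disjoint second graph realizes \<open>2 b - 1\<close>.\<close>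

section \<open>Vertex covers containing a prescribed set\<close>

text \<open>The quantity \<open>f\<close> of the overview before \<open>OPT\<close> is subtracted.
  It replaces statements about the existence of optimal covers by arithmetic. For \<open>Y\<close>
  outside \<open>verts G\<close> the minimum ranges over nothing, so its value is used only for
  subsets of the vertex set.\<close>

definition opt_cover :: "graph \<Rightarrow> nat set \<Rightarrow> nat" where
  "opt_cover G Y = (LEAST k. \<exists>X. vertex_cover G X \<and> Y \<subseteq> X \<and> card X = k)"

lemma verts_induced [simp]: "verts (induced G S) = S"
  by (simp add: induced_def verts_def)

lemma edges_induced [simp]: "edges (induced G S) = {e \<in> edges G. e \<subseteq> S}"
  by (simp add: induced_def edges_def)

lemma graph_eqI: "verts G = verts H \<Longrightarrow> edges G = edges H \<Longrightarrow> G = H"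
  by (simp add: verts_def edges_def prod_eq_iff)

lemma wf_graph_finite: "wf_graph G \<Longrightarrow> finite (verts G)"
  by (simp add: wf_graph_def)

lemma wf_graph_edgeE:
  assumes "wf_graph G" "e \<in> edges G"
  obtains u v where "u \<noteq> v" "e = {u, v}" "u \<in> verts G" "v \<in> verts G"
  using assms unfolding wf_graph_def by blast

lemma wf_graph_edge_subset: "wf_graph G \<Longrightarrow> e \<in> edges G \<Longrightarrow> e \<subseteq> verts G"
  by (auto elim: wf_graph_edgeE)

lemma wf_graph_induced:
  assumes "wf_graph G" "S \<subseteq> verts G"
  shows "wf_graph (induced G S)"
  unfolding wf_graph_def
proof (intro conjI ballI)
  show "finite (verts (induced G S))"
    using wf_graph_finite[OF assms(1)] assms(2) finite_subset by auto
  fix e assume "e \<in> edges (induced G S)"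
  then have "e \<in> edges G" "e \<subseteq> S" by auto
  with assms(1) show "\<exists>u v. u \<noteq> v \<and> e = {u, v} \<and> u \<in> verts (induced G S) \<and> v \<in> verts (induced G S)"
    by (elim wf_graph_edgeE) auto
qed

lemma induced_induced: "T \<subseteq> S \<Longrightarrow> induced (induced G S) T = induced G T"
  by (rule graph_eqI) auto

lemma induced_verts: "wf_graph G \<Longrightarrow> induced G (verts G) = G"
  by (rule graph_eqI) (auto dest: wf_graph_edge_subset)

lemma vertex_cover_verts: "wf_graph G \<Longrightarrow> vertex_cover G (verts G)"
  unfolding vertex_cover_def by (auto elim: wf_graph_edgeE)

lemma vertex_cover_finite: "wf_graph G \<Longrightarrow> vertex_cover G X \<Longrightarrow> finite X"
  unfolding vertex_cover_def using wf_graph_finite finite_subset by blast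

lemma opt_cover_attained:
  assumes "wf_graph G" "Y \<subseteq> verts G"
  obtains X where "vertex_cover G X" "Y \<subseteq> X" "card X = opt_cover G Y"
proof -
  have "\<exists>X. vertex_cover G X \<and> Y \<subseteq> X \<and> card X = card (verts G)"
    using vertex_cover_verts[OF assms(1)] assms(2) by blast
  then have "\<exists>X. vertex_cover G X \<and> Y \<subseteq> X \<and> card X = opt_cover G Y"
    unfolding opt_cover_def by (rule LeastI)
  then show thesis using that by blast
qed

lemma opt_cover_le: "vertex_cover G X \<Longrightarrow> Y \<subseteq> X \<Longrightarrow> opt_cover G Y \<le> card X"
  unfolding opt_cover_def by (rule Least_le) blast

lemma OPT_eq_opt_cover: "OPT G = opt_cover G {}"
  by (simp add: OPT_def opt_cover_def)

lemma opt_cover_mono: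
  assumes "wf_graph G" "Z \<subseteq> verts G" "Y \<subseteq> Z"
  shows "opt_cover G Y \<le> opt_cover G Z"
  using opt_cover_attained[OF assms(1,2)] opt_cover_le assms(3) by (metis order_trans)

lemma opt_cover_insert_le:
  assumes "wf_graph G" "insert y Y \<subseteq> verts G"
  shows "opt_cover G (insert y Y) \<le> opt_cover G Y + 1"
proof -
  obtain X where X: "vertex_cover G X" "Y \<subseteq> X" "card X = opt_cover G Y"
    using opt_cover_attained[of G Y] assms by auto
  have "vertex_cover G (insert y X)"
    using X(1) assms(2) unfolding vertex_cover_def by blast
  then have "opt_cover G (insert y Y) \<le> card (insert y X)"
    using X(2) by (intro opt_cover_le) auto
  also have "\<dots> \<le> card X + 1"
    using vertex_cover_finite[OF assms(1) X(1)] by (simp add: card_insert_if)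
  finally show ?thesis using X(3) by simp
qed

text \<open>Once \<open>Z\<close> is paid for, every edge meeting it is covered, and what remains is
  a cover problem on \<open>G - Z\<close>. Hence raising the cost beyond that of \<open>Z\<close> is
  a blocking question in an induced subgraph.\<close>

lemma opt_cover_Un:
  assumes "wf_graph G" "Z \<subseteq> verts G" "W \<subseteq> verts G - Z"
  shows "opt_cover G (Z \<union> W) = card Z + opt_cover (induced G (verts G - Z)) W"
proof (rule antisym)
  let ?H = "induced G (verts G - Z)"
  have wfH: "wf_graph ?H" using assms(1) by (rule wf_graph_induced) auto
  obtain X where X: "vertex_cover ?H X" "W \<subseteq> X" "card X = opt_cover ?H W"
    using opt_cover_attained[OF wfH, of W] assms(3) by auto
  have "vertex_cover G (Z \<union> X)"
    unfolding vertex_cover_def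
  proof (intro conjI ballI)
    show "Z \<union> X \<subseteq> verts G" using X(1) assms(2) unfolding vertex_cover_def by auto
    fix e assume e: "e \<in> edges G"
    show "e \<inter> (Z \<union> X) \<noteq> {}"
    proof (cases "e \<subseteq> verts G - Z")
      case True
      then show ?thesis using X(1) e unfolding vertex_cover_def by auto
    next
      case False
      then show ?thesis using wf_graph_edge_subset[OF assms(1) e] by blast
    qed
  qed
  then have "opt_cover G (Z \<union> W) \<le> card (Z \<union> X)" using X(2) by (intro opt_cover_le) auto
  also have "\<dots> \<le> card Z + card X" by (rule card_Un_le)
  finally show "opt_cover G (Z \<union> W) \<le> card Z + opt_cover ?H W" using X(3) by simp
next
  let ?H = "induced G (verts G - Z)"
  obtain X where X: "vertex_cover G X" "Z \<union> W \<subseteq> X" "card X = opt_cover G (Z \<union> W)"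
    using opt_cover_attained[OF assms(1), of "Z \<union> W"] assms by auto
  have fin: "finite X" using vertex_cover_finite[OF assms(1) X(1)] .
  have "vertex_cover ?H (X - Z)" using X(1) unfolding vertex_cover_def by fastforce
  then have "opt_cover ?H W \<le> card (X - Z)"
    using X(2) assms(3) by (intro opt_cover_le) auto
  also have "card (X - Z) = card X - card Z"
    using X(2) fin by (intro card_Diff_subset) (auto intro: finite_subset)
  finally show "card Z + opt_cover ?H W \<le> opt_cover G (Z \<union> W)"
    using X(2,3) card_mono[OF fin, of Z] by auto
qed

text \<open>No edge crosses between pieces, so covers can be chosen independently in each. The
  pieces are arbitrary, not just components, because traces of components on a vertex set also
  occur.\<close>

lemma opt_cover_partition:
  assumes wf: "wf_graph G" and P: "\<Union>P = verts G" "pairwise disjnt P"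
    and E: "\<And>e. e \<in> edges G \<Longrightarrow> \<exists>p\<in>P. e \<subseteq> p" and Y: "Y \<subseteq> verts G"
  shows "opt_cover G Y = (\<Sum>p\<in>P. opt_cover (induced G p) (Y \<inter> p))"
proof (rule antisym)
  have finV: "finite (verts G)" using wf by (rule wf_graph_finite)
  have finP: "finite P" using finV P(1) by (metis finite_UnionD)
  have sub: "p \<subseteq> verts G" if "p \<in> P" for p using that P(1) by blast
  have finp: "finite p" if "p \<in> P" for p using sub[OF that] finV finite_subset by blast
  have "\<exists>X. vertex_cover (induced G p) X \<and> Y \<inter> p \<subseteq> X \<and> card X = opt_cover (induced G p) (Y \<inter> p)"
    if "p \<in> P" for p
    using opt_cover_attained[OF wf_graph_induced[OF wf sub[OF that]], of "Y \<inter> p"] by auto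
  then obtain X where X: "\<And>p. p \<in> P \<Longrightarrow> vertex_cover (induced G p) (X p)"
      "\<And>p. p \<in> P \<Longrightarrow> Y \<inter> p \<subseteq> X p"
      "\<And>p. p \<in> P \<Longrightarrow> card (X p) = opt_cover (induced G p) (Y \<inter> p)"
    by metis
  have "vertex_cover G (\<Union>p\<in>P. X p)"
    unfolding vertex_cover_def
  proof (intro conjI ballI)
    show "(\<Union>p\<in>P. X p) \<subseteq> verts G" using X(1) sub unfolding vertex_cover_def by fastforce
    fix e assume e: "e \<in> edges G"
    then obtain p where p: "p \<in> P" "e \<subseteq> p" using E by blast
    then have "e \<inter> X p \<noteq> {}" using X(1)[OF p(1)] e unfolding vertex_cover_def by simp
    then show "e \<inter> (\<Union>p\<in>P. X p) \<noteq> {}" using p by blast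
  qed
  moreover have "Y \<subseteq> (\<Union>p\<in>P. X p)"
  proof
    fix y assume y: "y \<in> Y"
    then obtain p where "p \<in> P" "y \<in> p" using Y P(1) by (metis UnionE subsetD)
    then show "y \<in> (\<Union>p\<in>P. X p)" using X(2)[of p] y by blast
  qed
  ultimately have "opt_cover G Y \<le> card (\<Union>p\<in>P. X p)" by (rule opt_cover_le)
  also have "\<dots> \<le> (\<Sum>p\<in>P. card (X p))" using finP by (rule card_UN_le)
  also have "\<dots> = (\<Sum>p\<in>P. opt_cover (induced G p) (Y \<inter> p))" using X(3) by simp
  finally show "opt_cover G Y \<le> \<dots>" .
next
  have finV: "finite (verts G)" using wf by (rule wf_graph_finite)
  have finP: "finite P" using finV P(1) by (metis finite_UnionD)
  obtain X where X: "vertex_cover G X" "Y \<subseteq> X" "card X = opt_cover G Y"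
    using opt_cover_attained[OF wf Y] .
  have finX: "finite X" using vertex_cover_finite[OF wf X(1)] .
  have "(\<Sum>p\<in>P. opt_cover (induced G p) (Y \<inter> p)) \<le> (\<Sum>p\<in>P. card (X \<inter> p))"
  proof (rule sum_mono)
    fix p assume "p \<in> P"
    have "vertex_cover (induced G p) (X \<inter> p)" using X(1) unfolding vertex_cover_def by fastforce
    then show "opt_cover (induced G p) (Y \<inter> p) \<le> card (X \<inter> p)"
      using X(2) by (intro opt_cover_le) auto
  qed
  also have "\<dots> = card (\<Union>p\<in>P. X \<inter> p)"
  proof (rule card_UN_disjoint[symmetric])
    show "\<forall>i\<in>P. \<forall>j\<in>P. i \<noteq> j \<longrightarrow> X \<inter> i \<inter> (X \<inter> j) = {}"
      using P(2) unfolding pairwise_def disjnt_def by blast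
  qed (use finP finX in auto)
  also have "(\<Union>p\<in>P. X \<inter> p) = X \<inter> \<Union>P" by blast
  also have "\<dots> = X" using X(1) P(1) by (simp add: vertex_cover_def Int_absorb2)
  finally show "(\<Sum>p\<in>P. opt_cover (induced G p) (Y \<inter> p)) \<le> opt_cover G Y" using X(3) by simp
qed

section \<open>Invariance under relabelling\<close>

lemma opt_cover_map_graph:
  assumes wf: "wf_graph G" and f: "inj f" and Y: "Y \<subseteq> verts G"
  shows "opt_cover (map_graph f G) (f ` Y) = opt_cover G Y"
proof -
  have vc: "vertex_cover (map_graph f G) (f ` X) \<longleftrightarrow> vertex_cover G X" for X
  proof -
    have "f ` e \<inter> f ` X \<noteq> {} \<longleftrightarrow> e \<inter> X \<noteq> {}" for e using f by (auto simp: inj_def)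
    then show ?thesis
      using f unfolding vertex_cover_def map_graph_def verts_def edges_def
      by (auto simp: inj_image_subset_iff)
  qed
  have "(\<exists>X'. vertex_cover (map_graph f G) X' \<and> f ` Y \<subseteq> X' \<and> card X' = k) \<longleftrightarrow>
      (\<exists>X. vertex_cover G X \<and> Y \<subseteq> X \<and> card X = k)" for k
  proof
    assume "\<exists>X'. vertex_cover (map_graph f G) X' \<and> f ` Y \<subseteq> X' \<and> card X' = k"
    then obtain X' where X': "vertex_cover (map_graph f G) X'" "f ` Y \<subseteq> X'" "card X' = k" by blast
    have "X' \<subseteq> f ` verts G"
      using X'(1) unfolding vertex_cover_def by (simp add: map_graph_def verts_def)
    then obtain X where "X' = f ` X" by (meson subset_imageE)
    then show "\<exists>X. vertex_cover G X \<and> Y \<subseteq> X \<and> card X = k"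
      using X' vc f by (metis card_image inj_image_subset_iff inj_on_subset top_greatest)
  next
    assume "\<exists>X. vertex_cover G X \<and> Y \<subseteq> X \<and> card X = k"
    then show "\<exists>X'. vertex_cover (map_graph f G) X' \<and> f ` Y \<subseteq> X' \<and> card X' = k"
      using vc f by (metis card_image image_mono inj_on_subset top_greatest)
  qed
  then show ?thesis unfolding opt_cover_def by simp
qed

section \<open>Minimal blocking sets\<close>

lemma blocking_set_iff:
  assumes "wf_graph G"
  shows "blocking_set G Y \<longleftrightarrow> Y \<subseteq> verts G \<and> OPT G < opt_cover G Y"
proof (cases "Y \<subseteq> verts G")
  case True
  have le: "OPT G \<le> opt_cover G Y"
    unfolding OPT_eq_opt_cover using assms True by (rule opt_cover_mono) simp
  have "(\<exists>X. min_vertex_cover G X \<and> Y \<subseteq> X) \<longleftrightarrow> opt_cover G Y \<le> OPT G"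
  proof
    assume "opt_cover G Y \<le> OPT G"
    then show "\<exists>X. min_vertex_cover G X \<and> Y \<subseteq> X"
      using opt_cover_attained[OF assms True] le unfolding min_vertex_cover_def
      by (metis le_antisym)
  qed (auto simp: min_vertex_cover_def dest: opt_cover_le)
  then show ?thesis using True by (auto simp: blocking_set_def)
qed (simp add: blocking_set_def)

lemma minimal_blocking_setD:
  assumes "wf_graph G" "minimal_blocking_set G Y"
  shows "Y \<subseteq> verts G" "OPT G < opt_cover G Y" "finite Y" "Y \<noteq> {}"
    and minimal_blocking_set_eqI: "\<And>T. T \<subseteq> Y \<Longrightarrow> OPT G < opt_cover G T \<Longrightarrow> T = Y"
proof -
  show *: "Y \<subseteq> verts G" "OPT G < opt_cover G Y"
    using assms by (auto simp: minimal_blocking_set_def blocking_set_iff)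
  show "finite Y" using * wf_graph_finite[OF assms(1)] finite_subset by blast
  show "Y \<noteq> {}" using * by (auto simp: OPT_eq_opt_cover)
  show "\<And>T. T \<subseteq> Y \<Longrightarrow> OPT G < opt_cover G T \<Longrightarrow> T = Y"
    using assms * by (auto simp: minimal_blocking_set_def blocking_set_iff)
qed

lemma opt_cover_minimal_blocking_set_remove:
  assumes "wf_graph G" "minimal_blocking_set G Y" "y \<in> Y"
  shows "opt_cover G (Y - {y}) = OPT G"
proof (rule antisym)
  note Y = minimal_blocking_setD[OF assms(1,2)]
  have "Y - {y} \<noteq> Y" using assms(3) by blast
  then show "opt_cover G (Y - {y}) \<le> OPT G" using Y(5)[of "Y - {y}"] by (meson Diff_subset not_le)
  show "OPT G \<le> opt_cover G (Y - {y})"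
    unfolding OPT_eq_opt_cover using Y(1) by (intro opt_cover_mono[OF assms(1)]) auto
qed

text \<open>Removing any one vertex brings the cost back to the optimum, and a single vertex adds at
  most one.\<close>

lemma opt_cover_minimal_blocking_set:
  assumes "wf_graph G" "minimal_blocking_set G Y"
  shows "opt_cover G Y = OPT G + 1"
proof -
  note Y = minimal_blocking_setD[OF assms]
  obtain y where y: "y \<in> Y" using Y(4) by blast
  have "opt_cover G Y \<le> opt_cover G (Y - {y}) + 1"
    using opt_cover_insert_le[OF assms(1), of y "Y - {y}"] Y(1) y by (simp add: insert_absorb)
  then show ?thesis
    using Y(2) opt_cover_minimal_blocking_set_remove[OF assms y] by simp
qed

lemma minimal_blocking_setI:
  assumes "wf_graph G" "Y \<subseteq> verts G" "OPT G < opt_cover G Y"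
    and "\<And>y. y \<in> Y \<Longrightarrow> opt_cover G (Y - {y}) \<le> OPT G"
  shows "minimal_blocking_set G Y"
proof -
  have "opt_cover G Z \<le> OPT G" if Z: "Z \<subset> Y" for Z
  proof -
    obtain y where "y \<in> Y" "Z \<subseteq> Y - {y}" using Z by blast
    then show ?thesis
      using opt_cover_mono[OF assms(1), of "Y - {y}" Z] assms(2) assms(4)[of y] by fastforce
  qed
  then show ?thesis
    using assms(1-3) unfolding minimal_blocking_set_def blocking_set_iff[OF assms(1)]
    by (meson leD)
qed

lemma minimal_blocking_subset:
  assumes "wf_graph G" "Y \<subseteq> verts G" "OPT G < opt_cover G Y"
  obtains T where "T \<subseteq> Y" "minimal_blocking_set G T"
proof -
  have "finite Y" using assms(2) wf_graph_finite[OF assms(1)] finite_subset by blast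
  moreover have "blocking_set G Y" using assms by (simp add: blocking_set_iff)
  ultimately have "\<exists>T\<subseteq>Y. minimal_blocking_set G T"
  proof (induction Y rule: finite_psubset_induct)
    case (psubset Y)
    then show ?case unfolding minimal_blocking_set_def by (metis order.refl order_trans psubsetE)
  qed
  then show thesis using that by blast
qed

lemma minimal_blocking_set_map_graph:
  assumes "wf_graph G" "inj f" "wf_graph (map_graph f G)" "minimal_blocking_set G Y"
  shows "minimal_blocking_set (map_graph f G) (f ` Y)"
proof (rule minimal_blocking_setI[OF assms(3)])
  note Y = minimal_blocking_setD[OF assms(1,4)]
  have opt: "OPT (map_graph f G) = OPT G"
    using opt_cover_map_graph[OF assms(1,2), of "{}"] by (simp add: OPT_eq_opt_cover)
  show "f ` Y \<subseteq> verts (map_graph f G)" using Y(1) by (auto simp: map_graph_def verts_def)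
  show "OPT (map_graph f G) < opt_cover (map_graph f G) (f ` Y)"
    using Y(1,2) opt opt_cover_map_graph[OF assms(1,2)] by simp
  fix y' assume "y' \<in> f ` Y"
  then obtain y where y: "y \<in> Y" "y' = f y" by blast
  have "f ` Y - {y'} = f ` (Y - {y})" using y assms(2) by (auto simp: inj_def)
  moreover have "opt_cover G (Y - {y}) \<le> OPT G"
    using opt_cover_minimal_blocking_set_remove[OF assms(1,4) y(1)] by simp
  ultimately show "opt_cover (map_graph f G) (f ` Y - {y'}) \<le> OPT (map_graph f G)"
    using opt opt_cover_map_graph[OF assms(1,2), of "Y - {y}"] Y(1) by fastforce
qed

text \<open>A blocking set must exceed the optimum in some piece. Its part in that piece already
  blocks all of \<open>G\<close>, so minimality leaves nothing outside the piece.\<close>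

lemma minimal_blocking_set_partition:
  assumes wf: "wf_graph G" and P: "\<Union>P = verts G" "pairwise disjnt P"
    and E: "\<And>e. e \<in> edges G \<Longrightarrow> \<exists>p\<in>P. e \<subseteq> p" and Y: "minimal_blocking_set G Y"
  obtains p where "p \<in> P" "minimal_blocking_set (induced G p) Y"
proof -
  note mY = minimal_blocking_setD[OF wf Y]
  have finP: "finite P" using wf_graph_finite[OF wf] P(1) by (metis finite_UnionD)
  have sub: "p \<subseteq> verts G" if "p \<in> P" for p using that P(1) by blast
  have wfp: "wf_graph (induced G p)" if "p \<in> P" for p using wf_graph_induced[OF wf sub[OF that]] .
  have sum: "opt_cover G Z = (\<Sum>p\<in>P. opt_cover (induced G p) (Z \<inter> p))" if "Z \<subseteq> verts G" for Z
    using wf P E that by (rule opt_cover_partition)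
  have sum0: "OPT G = (\<Sum>p\<in>P. OPT (induced G p))"
    using sum[of "{}"] by (simp add: OPT_eq_opt_cover)
  have ge: "OPT (induced G p) \<le> opt_cover (induced G p) (Z \<inter> p)" if "p \<in> P" for p Z
    unfolding OPT_eq_opt_cover using opt_cover_mono[OF wfp[OF that], of "Z \<inter> p" "{}"] by simp
  \<comment> \<open>A surplus in one piece cannot be offset elsewhere, since no other summand falls
    below its own optimum.\<close>
  have blockI: "OPT G < opt_cover G Z"
    if "p \<in> P" "Z \<subseteq> verts G" "OPT (induced G p) < opt_cover (induced G p) (Z \<inter> p)" for p Z
    unfolding sum0 sum[OF that(2)] using finP ge that by (intro sum_strict_mono_ex1) auto
  obtain p where p: "p \<in> P" "OPT (induced G p) < opt_cover (induced G p) (Y \<inter> p)"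
  proof -
    have "\<not> (\<forall>p\<in>P. opt_cover (induced G p) (Y \<inter> p) \<le> OPT (induced G p))"
      using mY(2) unfolding sum0 sum[OF mY(1)] by (meson not_le sum_mono)
    then show thesis using that by (meson not_le)
  qed
  have "OPT G < opt_cover G (Y \<inter> p)" using p mY(1) by (intro blockI[of p]) auto
  then have Yp: "Y \<inter> p = Y" by (intro mY(5)) auto
  have "minimal_blocking_set (induced G p) Y"
  proof (rule minimal_blocking_setI[OF wfp[OF p(1)]])
    show "Y \<subseteq> verts (induced G p)" using Yp by auto
    show "OPT (induced G p) < opt_cover (induced G p) Y" using p(2) Yp by simp
    fix y assume y: "y \<in> Y"
    have "\<not> OPT G < opt_cover G (Y - {y})" using mY(5)[of "Y - {y}"] y by blast
    then have "\<not> OPT (induced G p) < opt_cover (induced G p) ((Y - {y}) \<inter> p)"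
      using blockI[OF p(1), of "Y - {y}"] mY(1) by blast
    moreover have "(Y - {y}) \<inter> p = Y - {y}" using Yp by blast
    ultimately show "opt_cover (induced G p) (Y - {y}) \<le> OPT (induced G p)" by simp
  qed
  with p(1) show thesis using that by blast
qed

section \<open>Adding a vertex\<close>

definition nbrs :: "graph \<Rightarrow> nat \<Rightarrow> nat set" where
  "nbrs G v = {u. {u, v} \<in> edges G}"

lemma verts_del_vertex [simp]: "verts (del_vertex G v) = verts G - {v}"
  by (simp add: del_vertex_def)

lemma wf_graph_del_vertex: "wf_graph G \<Longrightarrow> wf_graph (del_vertex G v)"
  unfolding del_vertex_def by (rule wf_graph_induced) auto

lemma nbrs_subset:
  assumes "wf_graph G"
  shows "nbrs G v \<subseteq> verts G - {v}"
proof
  fix u assume "u \<in> nbrs G v"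
  then have "{u, v} \<in> edges G" by (simp add: nbrs_def)
  with assms obtain a b where "a \<noteq> b" "{u, v} = {a, b}" "a \<in> verts G" "b \<in> verts G"
    by (rule wf_graph_edgeE)
  then show "u \<in> verts G - {v}" by (auto simp: doubleton_eq_iff)
qed

lemma opt_cover_insert_vertex:
  assumes "wf_graph G" "v \<in> verts G" "Y \<subseteq> verts G - {v}"
  shows "opt_cover G (insert v Y) = 1 + opt_cover (del_vertex G v) Y"
  using opt_cover_Un[OF assms(1), of "{v}" Y] assms(2,3) by (simp add: del_vertex_def)

text \<open>A cover either contains \<open>v\<close>, which costs one, or avoids \<open>v\<close>
  and then contains all its neighbours.\<close>

lemma opt_cover_del_vertex:
  assumes wf: "wf_graph G" and v: "v \<in> verts G" and Y: "Y \<subseteq> verts G - {v}"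
  shows "opt_cover G Y = min (1 + opt_cover (del_vertex G v) Y)
    (opt_cover (del_vertex G v) (nbrs G v \<union> Y))"
proof (rule antisym)
  let ?H = "del_vertex G v"
  have "opt_cover G Y \<le> 1 + opt_cover ?H Y"
    using opt_cover_mono[OF wf, of "insert v Y" Y] opt_cover_insert_vertex[OF assms] v Y by auto
  moreover have "opt_cover G Y \<le> opt_cover ?H (nbrs G v \<union> Y)"
  proof -
    obtain X where X: "vertex_cover ?H X" "nbrs G v \<union> Y \<subseteq> X"
        "card X = opt_cover ?H (nbrs G v \<union> Y)"
      using opt_cover_attained[OF wf_graph_del_vertex[OF wf, of v], of "nbrs G v \<union> Y"]
        nbrs_subset[OF wf, of v] Y by auto
    have "vertex_cover G X" unfolding vertex_cover_def
    proof (intro conjI ballI)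
      show "X \<subseteq> verts G" using X(1) unfolding vertex_cover_def by auto
      fix e assume e: "e \<in> edges G"
      show "e \<inter> X \<noteq> {}"
      proof (cases "v \<in> e")
        case True
        obtain a b where ab: "e = {a, b}" using wf e by (rule wf_graph_edgeE)
        with True obtain u where "e = {u, v}" by auto
        then show ?thesis using e X(2) by (auto simp: nbrs_def)
      next
        case False
        then have "e \<in> edges ?H"
          using e wf_graph_edge_subset[OF wf e] by (auto simp: del_vertex_def)
        then show ?thesis using X(1) by (simp add: vertex_cover_def)
      qed
    qed
    then show ?thesis using X(2,3) opt_cover_le[of G X Y] by auto
  qed
  ultimately show "opt_cover G Y \<le> min (1 + opt_cover ?H Y) (opt_cover ?H (nbrs G v \<union> Y))"
    by simp
next
  let ?H = "del_vertex G v"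
  obtain X where X: "vertex_cover G X" "Y \<subseteq> X" "card X = opt_cover G Y"
    using opt_cover_attained[OF wf, of Y] Y by auto
  show "min (1 + opt_cover ?H Y) (opt_cover ?H (nbrs G v \<union> Y)) \<le> opt_cover G Y"
  proof (cases "v \<in> X")
    case True
    then have "opt_cover G (insert v Y) \<le> card X" using X by (intro opt_cover_le) auto
    then show ?thesis using opt_cover_insert_vertex[OF assms] X(3) by simp
  next
    case False
    have "vertex_cover ?H X"
      using X(1) False unfolding vertex_cover_def by (auto simp: del_vertex_def)
    moreover have "nbrs G v \<subseteq> X"
      using X(1) False unfolding vertex_cover_def nbrs_def by auto
    ultimately have "opt_cover ?H (nbrs G v \<union> Y) \<le> card X" using X(2) by (intro opt_cover_le) auto
    then show ?thesis using X(3) by simp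
  qed
qed

section \<open>The upper bound\<close>

text \<open>Induced subgraphs are included because extending a set \<open>Z\<close> uses minimal
  blocking sets of \<open>G - Z\<close>; this also makes the bound stable under iteration.\<close>

definition blocking_bounded :: "graph \<Rightarrow> nat \<Rightarrow> bool" where
  "blocking_bounded G b \<longleftrightarrow>
    (\<forall>S Y. S \<subseteq> verts G \<longrightarrow> minimal_blocking_set (induced G S) Y \<longrightarrow> card Y \<le> b)"

lemma blocking_bounded_induced:
  "blocking_bounded G b \<Longrightarrow> S \<subseteq> verts G \<Longrightarrow> blocking_bounded (induced G S) b"
  unfolding blocking_bounded_def by (auto simp: induced_induced)

text \<open>\<open>W - Z\<close> blocks in \<open>G - Z\<close>, so it contains a minimal blocking
  set there, which has at most \<open>b\<close> vertices and exceeds the optimum by exactly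
  one.\<close>

lemma blocking_bounded_extend:
  assumes wf: "wf_graph G" and bnd: "blocking_bounded G b"
    and ZW: "Z \<subseteq> W" "W \<subseteq> verts G" and lt: "opt_cover G Z < opt_cover G W"
  obtains T where "T \<subseteq> W - Z" "card T \<le> b" "opt_cover G (Z \<union> T) = opt_cover G Z + 1"
proof -
  let ?H = "induced G (verts G - Z)"
  have Z: "Z \<subseteq> verts G" using ZW by blast
  have wfH: "wf_graph ?H" using wf by (rule wf_graph_induced) auto
  have eq: "opt_cover G (Z \<union> T) = card Z + opt_cover ?H T" if "T \<subseteq> verts G - Z" for T
    using wf Z that by (rule opt_cover_Un)
  have eqZ: "opt_cover G Z = card Z + OPT ?H" using eq[of "{}"] by (simp add: OPT_eq_opt_cover)
  have "Z \<union> (W - Z) = W" using ZW by blast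
  then have "OPT ?H < opt_cover ?H (W - Z)" using eq[OF Diff_mono[OF ZW(2) order_refl]] eqZ lt by simp
  then obtain T where T: "T \<subseteq> W - Z" "minimal_blocking_set ?H T"
    using minimal_blocking_subset[OF wfH, of "W - Z"] ZW(2) by auto
  note mT = minimal_blocking_setD[OF wfH T(2)]
  have "card T \<le> b" using bnd T(2) unfolding blocking_bounded_def by blast
  moreover have "opt_cover ?H T = OPT ?H + 1" using wfH T(2) by (rule opt_cover_minimal_blocking_set)
  ultimately show thesis using that[of T] T(1) eq[of T] eqZ mT(1) by simp
qed

text \<open>Every case finds a small subset of \<open>Y\<close> that still blocks and therefore
  equals \<open>Y\<close>. The term \<open>b + 1\<close> allows for \<open>v\<close> itself lying in
  \<open>Y\<close>; the term \<open>2 * b - 1\<close> arises only when optimal covers with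
  \<open>v\<close> and without \<open>v\<close> both exist.\<close>

lemma minimal_blocking_set_add_vertex_bound:
  assumes wf: "wf_graph G" and v: "v \<in> verts G" and bnd: "blocking_bounded (del_vertex G v) b"
    and Y: "minimal_blocking_set G Y"
  shows "card Y \<le> max (b + 1) (2 * b - 1)"
proof -
  let ?H = "del_vertex G v"
  define N where "N = nbrs G v"
  define h where "h = opt_cover ?H"
  note mY = minimal_blocking_setD[OF wf Y]
  have wfH: "wf_graph ?H" using wf by (rule wf_graph_del_vertex)
  have N: "N \<subseteq> verts G - {v}" unfolding N_def using wf by (rule nbrs_subset)
  have out: "opt_cover G T = min (1 + h T) (h (N \<union> T))" if "T \<subseteq> verts G - {v}" for T
    unfolding h_def N_def using wf v that by (rule opt_cover_del_vertex)
  have into: "opt_cover G (insert v T) = 1 + h T" if "T \<subseteq> verts G - {v}" for T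
    unfolding h_def using wf v that by (rule opt_cover_insert_vertex)
  have opt: "OPT G = min (1 + h {}) (h N)" using out[of "{}"] by (simp add: OPT_eq_opt_cover)
  have mono: "h S \<le> h T" if "S \<subseteq> T" "T \<subseteq> verts G - {v}" for S T
    unfolding h_def using opt_cover_mono[OF wfH, of T S] that by simp
  have extend: "\<exists>T \<subseteq> W - Z. card T \<le> b \<and> h (Z \<union> T) = h Z + 1"
    if "Z \<subseteq> W" "W \<subseteq> verts G - {v}" "h Z < h W" for Z W
    using blocking_bounded_extend[OF wfH bnd, of Z W] that unfolding h_def
    by (metis verts_del_vertex)
  show ?thesis
  proof (cases "v \<in> Y")
    case True
    define Y' where "Y' = Y - {v}"
    have Y': "Y = insert v Y'" "Y' \<subseteq> verts G - {v}" using True mY(1) by (auto simp: Y'_def)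
    show ?thesis
    \<comment> \<open>If \<open>h N\<close> does not exceed \<open>h {}\<close>, omitting
      \<open>v\<close> is strictly cheaper and \<open>{v}\<close> alone blocks. Otherwise covers
      with \<open>v\<close> attain the optimum, and one extension in \<open>G - v\<close> suffices
      beside \<open>v\<close>.\<close>
    proof (cases "h N \<le> h {}")
      case True
      then have "OPT G < opt_cover G {v}" using into[of "{}"] opt by simp
      then have "Y = {v}" using mY(5)[of "{v}"] Y' by blast
      then show ?thesis by simp
    next
      case False
      then have "h {} < h Y'" using mY(2) into[OF Y'(2)] opt Y'(1) by simp
      then obtain T where T: "T \<subseteq> Y'" "card T \<le> b" "h T = h {} + 1"
        using extend[of "{}" Y'] Y'(2) by auto
      then have "OPT G < opt_cover G (insert v T)" using into[of T] Y'(2) opt by auto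
      then have "insert v T = Y" using mY(5)[of "insert v T"] T(1) Y'(1) by blast
      then show ?thesis using T(2) card_insert_le_m1[of "b + 1" T v] by simp
    qed
  next
    case False
    then have YV: "Y \<subseteq> verts G - {v}" using mY(1) by blast
    \<comment> \<open>The two inequalities say that neither the covers with \<open>v\<close> nor
      those without \<open>v\<close> that contain \<open>T\<close> are optimal.\<close>
    have eqY: "T = Y" if "T \<subseteq> Y" "OPT G \<le> h T" "OPT G < h (N \<union> T)" for T
      using that mY(5)[of T] out[of T] YV by auto
    have hY: "OPT G < 1 + h Y" "OPT G < h (N \<union> Y)" using mY(2) out[OF YV] by auto
    have NY: "N \<union> Y \<subseteq> verts G - {v}" using N YV by blast
    have small: ?thesis if "T \<subseteq> Y" "OPT G \<le> h T" "OPT G < h (N \<union> T)" "card T \<le> b" for T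
      using eqY[OF that(1-3)] that(4) by simp
    \<comment> \<open>In the first case no optimal cover contains \<open>v\<close>, so only
      \<open>h (N \<union> T)\<close> has to rise; in the second all of them do, so only
      \<open>h T\<close> has to rise; in the third both must.\<close>
    consider "h N \<le> h {}" | "h N \<ge> h {} + 2" | "h N = h {} + 1" by linarith
    then show ?thesis
    proof cases
      case 1
      then have oN: "OPT G = h N" "h N = h {}" using opt mono[of "{}" N] N by auto
      then obtain T where T: "T \<subseteq> Y" "card T \<le> b" "h (N \<union> T) = h N + 1"
        using extend[of N "N \<union> Y"] hY(2) NY by auto
      have "h {} \<le> h T" using mono[of "{}" T] T(1) YV by blast
      then show ?thesis using small[of T] T oN by simp
    next
      case 2
      then have o: "OPT G = h {} + 1" using opt by simp
      then obtain T where T: "T \<subseteq> Y" "card T \<le> b" "h T = h {} + 1"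
        using extend[of "{}" Y] hY(1) YV by auto
      have "h N \<le> h (N \<union> T)" using mono[of N "N \<union> T"] T(1) NY by blast
      then show ?thesis using small[of T] T o 2 by simp
    next
      case 3
      then have o: "OPT G = h {} + 1" using opt by simp
      have "h N < h (N \<union> Y)" using hY(2) o 3 by simp
      then obtain T3 where T3: "T3 \<subseteq> Y" "card T3 \<le> b" "h (N \<union> T3) = h {} + 2"
        using extend[of N "N \<union> Y"] NY 3 by auto
      show ?thesis
      proof (cases "OPT G \<le> h T3")
        case True
        then show ?thesis using small[of T3] T3 o by simp
      next
        case False
        then have h3: "h T3 = h {}" using mono[OF empty_subsetI order_trans[OF T3(1) YV]] o by simp
        \<comment> \<open>Greedily completing a set that blocks only together with \<open>N\<close> shows that \<open>Y\<close> itself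
          costs just one extra vertex, so the second extension below must use a vertex of \<open>N\<close>.\<close>
        obtain T1 where T1: "T1 \<subseteq> Y" "h (T3 \<union> T1) = h {} + 1"
          using extend[of T3 Y] T3(1) YV hY(1) h3 o by auto
        have "h (N \<union> T3) \<le> h (N \<union> (T3 \<union> T1))"
          using mono[of "N \<union> T3" "N \<union> (T3 \<union> T1)"] T1(1) T3(1) NY by blast
        then have "T3 \<union> T1 = Y" using eqY[of "T3 \<union> T1"] T1 T3 o by simp
        then have hY1: "h Y = h {} + 1" using T1(2) by simp
        obtain T where T: "T \<subseteq> Y" "card T \<le> b" "h T = h {} + 1"
          using extend[of "{}" Y] YV hY1 by auto
        obtain T2 where T2: "T2 \<subseteq> N \<union> Y" "card T2 \<le> b" "h (T \<union> T2) = h {} + 2"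
          using extend[OF le_supI2[OF T(1)] NY] hY(2) T(3) o by auto
        have "\<not> T2 \<subseteq> Y"
          using mono[of "T \<union> T2" Y] T(1) T2(3) hY1 YV by auto
        moreover have "finite T2"
          using T2(1) NY wf_graph_finite[OF wf] by (meson finite_Diff finite_subset)
        ultimately have less: "card (T2 \<inter> Y) < card T2" by (intro psubset_card_mono) auto
        \<comment> \<open>\<open>T\<close> already rules out the optimal covers with
          \<open>v\<close>. Against those without \<open>v\<close>, the vertices of
          \<open>T2\<close> outside \<open>Y\<close> lie in \<open>N\<close> and are forced anyway,
          so only \<open>T2 \<inter> Y\<close> needs to be kept.\<close>
        have "h T \<le> h (T \<union> T2 \<inter> Y)" using mono[of T "T \<union> T2 \<inter> Y"] T(1) YV by blast
        moreover have "h (T \<union> T2) \<le> h (N \<union> (T \<union> T2 \<inter> Y))"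
          using T(1) T2(1) NY by (intro mono) auto
        ultimately have "T \<union> T2 \<inter> Y = Y" using eqY[of "T \<union> T2 \<inter> Y"] T T2(3) o by auto
        then have "card Y \<le> card T + card (T2 \<inter> Y)" using card_Un_le by metis
        then show ?thesis using T(2) T2(2) less by linarith
      qed
    qed
  qed
qed

lemma blocking_bounded_add_vertex:
  assumes wf: "wf_graph G" and v: "v \<in> verts G" and bnd: "blocking_bounded (del_vertex G v) b"
  shows "blocking_bounded G (max (b + 1) (2 * b - 1))"
  unfolding blocking_bounded_def
proof (intro allI impI)
  fix S Y assume S: "S \<subseteq> verts G" and Y: "minimal_blocking_set (induced G S) Y"
  have bndS: "blocking_bounded (induced G (S - {v})) b"
    using blocking_bounded_induced[OF bnd, of "S - {v}"] S
      induced_induced[of "S - {v}" "verts G - {v}" G]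
    unfolding del_vertex_def by (metis Diff_mono order_refl verts_induced)
  show "card Y \<le> max (b + 1) (2 * b - 1)"
  proof (cases "v \<in> S")
    case True
    have "del_vertex (induced G S) v = induced G (S - {v})"
      unfolding del_vertex_def by (simp add: induced_induced)
    then show ?thesis
      using minimal_blocking_set_add_vertex_bound[OF wf_graph_induced[OF wf S], of v b Y]
        True bndS Y by simp
  next
    case False
    then have "induced G (S - {v}) = induced G S" by simp
    then have "blocking_bounded (induced G S) b" using bndS by simp
    then have "card Y \<le> b" using Y unfolding blocking_bounded_def
      by (metis induced_induced order_refl verts_induced)
    then show ?thesis by simp
  qed
qed

section \<open>Components\<close>

lemma adj_sym: "adj G u w \<Longrightarrow> adj G w u"
  by (simp add: adj_def insert_commute)

lemma reach_sym: "reach G u w \<Longrightarrow> reach G w u"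
  unfolding reach_def by (rule sympD[OF symp_rtranclp]) (auto intro: sympI adj_sym)

lemma reach_refl: "reach G u u"
  by (simp add: reach_def)

lemma reach_trans: "reach G u w \<Longrightarrow> reach G w x \<Longrightarrow> reach G u x"
  unfolding reach_def by (rule rtranclp_trans)

lemma reach_adj: "adj G u w \<Longrightarrow> reach G u w"
  by (simp add: reach_def r_into_rtranclp)

lemma reach_mono: "edges G \<subseteq> edges H \<Longrightarrow> reach G u w \<Longrightarrow> reach H u w"
  unfolding reach_def by (erule rtranclp_mono[THEN predicate2D, rotated]) (auto simp: adj_def)

lemma reach_closed:
  assumes "reach G u w" "u \<in> A" "\<And>x y. adj G x y \<Longrightarrow> x \<in> A \<Longrightarrow> y \<in> A"
  shows "w \<in> A"
  using assms(1,2) unfolding reach_def by (induction rule: rtranclp_induct) (auto intro: assms(3))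

text \<open>Components as vertex sets rather than graphs, which is the form required by the
  partition lemmas.\<close>

definition component_sets :: "graph \<Rightarrow> nat set set" where
  "component_sets G = (\<lambda>v. {w \<in> verts G. reach G v w}) ` verts G"

lemma components_eq: "components G = induced G ` component_sets G"
  by (auto simp: components_def component_sets_def)

lemma component_sets_subset: "p \<in> component_sets G \<Longrightarrow> p \<subseteq> verts G"
  by (auto simp: component_sets_def)

lemma Union_component_sets: "\<Union>(component_sets G) = verts G"
  by (auto simp: component_sets_def intro: reach_refl)

lemma pairwise_disjnt_component_sets: "pairwise disjnt (component_sets G)"
proof (rule pairwiseI)
  fix p q assume "p \<in> component_sets G" "q \<in> component_sets G" "p \<noteq> q"
  then obtain u v where p: "p = {w \<in> verts G. reach G u w}" and q: "q = {w \<in> verts G. reach G v w}"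
    by (auto simp: component_sets_def)
  show "disjnt p q"
  proof (rule ccontr)
    assume "\<not> disjnt p q"
    then obtain w where "reach G u w" "reach G v w" using p q by (auto simp: disjnt_def)
    then have "reach G u x \<longleftrightarrow> reach G v x" for x by (meson reach_sym reach_trans)
    then show False using p q \<open>p \<noteq> q\<close> by simp
  qed
qed

lemma edge_in_component_set:
  assumes "wf_graph G" "e \<in> edges G"
  shows "\<exists>p\<in>component_sets G. e \<subseteq> p"
proof -
  obtain u v where e: "u \<noteq> v" "e = {u, v}" "u \<in> verts G" "v \<in> verts G"
    using assms by (rule wf_graph_edgeE)
  then have "reach G u v" using assms(2) by (intro reach_adj) (simp add: adj_def)
  then have "e \<subseteq> {w \<in> verts G. reach G u w}" using e reach_refl by auto
  then show ?thesis using e(3) by (auto simp: component_sets_def)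
qed

lemma connected_component:
  assumes "wf_graph G" "p \<in> component_sets G"
  shows "connected_graph (induced G p)"
proof -
  obtain v where v: "v \<in> verts G" "p = {w \<in> verts G. reach G v w}"
    using assms(2) by (auto simp: component_sets_def)
  have "reach (induced G p) v w" if "reach G v w" for w
    using that unfolding reach_def
  proof (induction rule: rtranclp_induct)
    case (step x y)
    have xy: "x \<in> verts G" "y \<in> verts G"
      using wf_graph_edge_subset[OF assms(1), of "{x, y}"] step(2) by (auto simp: adj_def)
    then have "x \<in> p" "y \<in> p"
      using step(1,2) v(2) unfolding reach_def by (auto intro: rtranclp.rtrancl_into_rtrancl)
    then have "adj (induced G p) x y" using step(2) by (auto simp: adj_def)
    with step(3) show ?case by (rule rtranclp.rtrancl_into_rtrancl)
  qed simp
  then have "reach (induced G p) v w" if "w \<in> p" for w using that v(2) by blast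
  then show ?thesis
    using v(1) unfolding connected_graph_def verts_induced
    by (metis (mono_tags, lifting) empty_iff mem_Collect_eq reach_refl reach_sym reach_trans v(2))
qed

lemma component_card_less:
  assumes "wf_graph G" "\<not> connected_graph G" "p \<in> component_sets G"
  shows "card p < card (verts G)"
proof -
  have "p \<noteq> verts G"
    using connected_component[OF assms(1,3)] assms(2) induced_verts[OF assms(1)] by auto
  then show ?thesis
    using component_sets_subset[OF assms(3)] wf_graph_finite[OF assms(1)]
    by (intro psubset_card_mono) auto
qed

lemma blocking_bounded_components:
  assumes wf: "wf_graph G" and bnd: "\<And>p. p \<in> component_sets G \<Longrightarrow> blocking_bounded (induced G p) b"
  shows "blocking_bounded G b"
  unfolding blocking_bounded_def
proof (intro allI impI)
  fix S Y assume S: "S \<subseteq> verts G" and Y: "minimal_blocking_set (induced G S) Y"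
  \<comment> \<open>These traces may be empty or disconnected in \<open>induced G S\<close>; all
    that matters is that no edge crosses between them.\<close>
  define P where "P = (\<lambda>p. p \<inter> S) ` component_sets G"
  have "\<Union>P = verts (induced G S)"
    using S Union_component_sets[of G] by (auto simp: P_def)
  moreover have "pairwise disjnt P"
    using pairwise_disjnt_component_sets[of G] unfolding P_def pairwise_def disjnt_def by blast
  moreover have "\<exists>p\<in>P. e \<subseteq> p" if "e \<in> edges (induced G S)" for e
    using edge_in_component_set[OF wf, of e] that by (auto simp: P_def)
  ultimately obtain q where q: "q \<in> P" "minimal_blocking_set (induced (induced G S) q) Y"
    using minimal_blocking_set_partition[OF wf_graph_induced[OF wf S], of P Y] Y by blast
  then obtain p where p: "p \<in> component_sets G" "q = p \<inter> S" by (auto simp: P_def)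
  then have "minimal_blocking_set (induced (induced G p) q) Y"
    using q(2) by (simp add: induced_induced)
  then show "card Y \<le> b" using bnd[OF p(1)] p(2) unfolding blocking_bounded_def by (metis inf_le1 verts_induced)
qed

section \<open>Elimination distance\<close>

lemma ed_le_mono: "ed_le C G k \<Longrightarrow> k \<le> l \<Longrightarrow> ed_le C G l"
proof (induction arbitrary: l rule: ed_le.induct)
  case (conn G v k)
  then obtain l' where "l = Suc l'" "k \<le> l'" by (metis Suc_le_D Suc_le_mono)
  then show ?case using conn by (auto intro: ed_le.conn)
qed (auto intro: ed_le.intros)

text \<open>The empty graph counts as disconnected and has no components, so rule
  \<open>disconn\<close> applies vacuously, whatever \<open>C\<close> is.\<close>

lemma ed_le_empty: "ed_le C ({}, {}) k"
  by (rule ed_le.disconn) (auto simp: connected_graph_def components_def verts_def)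

text \<open>Guarantees that the \<open>LEAST\<close> in \<open>elim_dist\<close> is attained:
  deleting vertices and splitting into components ends at the empty graph.\<close>

lemma ed_le_exists: "wf_graph G \<Longrightarrow> \<exists>k. ed_le C G k"
proof (induction "card (verts G)" arbitrary: G rule: less_induct)
  case less
  show ?case
  proof (cases "connected_graph G")
    case True
    then obtain v where v: "v \<in> verts G" by (auto simp: connected_graph_def)
    have "card (verts (del_vertex G v)) < card (verts G)"
      using card_Diff1_less[OF wf_graph_finite[OF less.prems] v] by simp
    then obtain k where "ed_le C (del_vertex G v) k"
      using less wf_graph_del_vertex by blast
    then show ?thesis using True v ed_le.conn by blast
  next
    case False
    have "\<exists>k. ed_le C (induced G p) k" if "p \<in> component_sets G" for p
      using less.hyps[of "induced G p"] component_card_less[OF less.prems False that]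
        wf_graph_induced[OF less.prems component_sets_subset[OF that]] by simp
    then obtain k where k: "\<And>p. p \<in> component_sets G \<Longrightarrow> ed_le C (induced G p) (k p)" by metis
    have fin: "finite (component_sets G)"
      using wf_graph_finite[OF less.prems] by (simp add: component_sets_def)
    \<comment> \<open>For the graph without vertices this is \<open>Max\<close> of the empty set;
      its value is harmless, as there is no component to bound.\<close>
    have "ed_le C (induced G p) (Max (k ` component_sets G))" if "p \<in> component_sets G" for p
      using k[OF that] by (rule ed_le_mono) (use fin that in auto)
    then have "\<forall>H\<in>components G. ed_le C H (Max (k ` component_sets G))"
      unfolding components_eq by blast
    then show ?thesis using ed_le.disconn[OF False] by blast
  qed
qed

lemma elim_dist_le_iff:
  assumes "wf_graph G"
  shows "elim_dist C G \<le> d \<longleftrightarrow> ed_le C G d"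
  unfolding elim_dist_def
  using LeastI_ex[OF ed_le_exists[OF assms, of C]] by (auto intro: ed_le_mono Least_le)

text \<open>From \<open>b = 2\<close> on the second term is the maximum, with equality at 2. The
  first term governs only the start \<open>0, 1, 2\<close>, where natural subtraction turns
  \<open>2 * 0 - 1\<close> into 0.\<close>

abbreviation blocking_step :: "nat \<Rightarrow> nat" where
  "blocking_step \<equiv> \<lambda>b. max (b + 1) (2 * b - 1)"

text \<open>Only vertex deletions cost a step; splitting into components preserves the bound.
  Heredity extends the bound on \<open>C\<close> to induced subgraphs at the base.\<close>

lemma ed_le_blocking_bounded:
  assumes "ed_le C G k" "hereditary C" "wf_graph G"
    and b: "\<forall>G\<in>C. \<forall>Y. minimal_blocking_set G Y \<longrightarrow> card Y \<le> b"
  shows "blocking_bounded G ((blocking_step ^^ k) b)"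
  using assms(1,3)
proof (induction rule: ed_le.induct)
  case (in_class G k)
  have "b \<le> (blocking_step ^^ k) b" by (induction k) auto
  moreover have "card Y \<le> b" if "S \<subseteq> verts G" "minimal_blocking_set (induced G S) Y" for S Y
    using that in_class(1) assms(2) b unfolding hereditary_def by blast
  ultimately show ?case unfolding blocking_bounded_def by (meson order_trans)
next
  case (conn G v k)
  then show ?case
    using blocking_bounded_add_vertex[OF conn.prems conn.hyps(2)] wf_graph_del_vertex by auto
next
  case (disconn G k)
  show ?case
  proof (rule blocking_bounded_components[OF disconn.prems])
    fix p assume "p \<in> component_sets G"
    then show "blocking_bounded (induced G p) ((blocking_step ^^ k) b)"
      using disconn.IH wf_graph_induced[OF disconn.prems component_sets_subset]
      by (simp add: components_eq)
  qed
qed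

section \<open>The lower bound\<close>

lemma card_le_opt_cover:
  assumes "wf_graph G" "Y \<subseteq> verts G"
  shows "card Y \<le> opt_cover G Y"
  using opt_cover_attained[OF assms] vertex_cover_finite[OF assms(1)] by (metis card_mono)

text \<open>Quantifying over all infinite vertex supplies provides disjoint copies without having to
  transport elimination distances along isomorphisms.\<close>

definition realizable :: "graph set \<Rightarrow> nat \<Rightarrow> nat \<Rightarrow> bool" where
  "realizable C k n \<longleftrightarrow> (\<forall>A. infinite A \<longrightarrow> (\<exists>G Y. wf_graph G \<and> verts G \<subseteq> A \<and>
    connected_graph G \<and> ed_le C G k \<and> minimal_blocking_set G Y \<and> card Y = n))"

text \<open>Closure under relabelling moves \<open>G\<close> into \<open>A\<close>. Connectedness
  comes from passing to the one component that contains the minimal blocking set, which stays in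
  \<open>C\<close> by heredity.\<close>

lemma realizable_in_class:
  assumes C: "graph_class C" "hereditary C" and G: "G \<in> C" and Y: "minimal_blocking_set G Y"
  shows "realizable C k (card Y)"
  unfolding realizable_def
proof (intro allI impI)
  fix A :: "nat set" assume "infinite A"
  then obtain f :: "nat \<Rightarrow> nat" where f: "inj f" "range f \<subseteq> A"
    using infinite_countable_subset by blast
  have wfG: "wf_graph G" using C(1) G by (simp add: graph_class_def)
  let ?G = "map_graph f G"
  have G': "?G \<in> C"
    using C(1) G f(1) unfolding graph_class_def by (meson inj_on_subset subset_UNIV)
  then have wf: "wf_graph ?G" using C(1) by (simp add: graph_class_def)
  obtain p where p: "p \<in> component_sets ?G" "minimal_blocking_set (induced ?G p) (f ` Y)"
    using minimal_blocking_set_partition[OF wf Union_component_sets pairwise_disjnt_component_sets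
        edge_in_component_set[OF wf] minimal_blocking_set_map_graph[OF wfG f(1) wf Y]] .
  have sub: "p \<subseteq> verts ?G" using p(1) by (rule component_sets_subset)
  have "induced ?G p \<in> C" using C(2) G' sub by (simp add: hereditary_def)
  moreover have "verts ?G \<subseteq> A" using f(2) by (auto simp: map_graph_def verts_def)
  moreover have "card (f ` Y) = card Y" using f(1) by (simp add: card_image inj_on_subset)
  ultimately show "\<exists>G' Y'. wf_graph G' \<and> verts G' \<subseteq> A \<and> connected_graph G' \<and> ed_le C G' k \<and>
      minimal_blocking_set G' Y' \<and> card Y' = card Y"
    using p(2) sub wf_graph_induced[OF wf sub] connected_component[OF wf p(1)]
    by (intro exI[of _ "induced ?G p"] exI[of _ "f ` Y"]) (auto intro: ed_le.in_class)
qed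

section \<open>Base graphs: a single vertex and a single edge\<close>

lemma ed_le_single_vertex: "ed_le C ({a}, {}) (Suc k)"
proof (rule ed_le.conn[of _ a])
  show "connected_graph ({a}, {})" by (auto simp: connected_graph_def verts_def reach_refl)
  have "del_vertex ({a}, {}) a = ({}, {})"
    by (simp add: del_vertex_def induced_def verts_def edges_def)
  then show "ed_le C (del_vertex ({a}, {}) a) k" by (simp add: ed_le_empty)
qed (simp add: verts_def)

lemma realizable_one: "realizable C (Suc k) 1"
  unfolding realizable_def
proof (intro allI impI)
  fix A :: "nat set" assume "infinite A"
  then obtain a where a: "a \<in> A" by (metis finite.emptyI ex_in_conv)
  let ?G = "({a}, {}) :: graph"
  have wf: "wf_graph ?G" by (simp add: wf_graph_def verts_def edges_def)
  have "vertex_cover ?G {}" by (simp add: vertex_cover_def edges_def)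
  then have "OPT ?G = 0" using opt_cover_le[of ?G "{}" "{}"] by (simp add: OPT_eq_opt_cover)
  then have "minimal_blocking_set ?G {a}"
    using card_le_opt_cover[OF wf, of "{a}"]
    by (intro minimal_blocking_setI[OF wf]) (auto simp: verts_def OPT_eq_opt_cover)
  moreover have "connected_graph ?G" by (auto simp: connected_graph_def verts_def reach_refl)
  moreover have "verts ?G \<subseteq> A" using a by (simp add: verts_def)
  ultimately show "\<exists>G Y. wf_graph G \<and> verts G \<subseteq> A \<and> connected_graph G \<and> ed_le C G (Suc k) \<and>
      minimal_blocking_set G Y \<and> card Y = 1"
    using wf ed_le_single_vertex by (intro exI[of _ ?G] exI[of _ "{a}"]) auto
qed

text \<open>Each end of an edge is an optimal cover, while both ends together are too many. The
  hypothesis is met either by single-vertex graphs in \<open>C\<close> or by one further elimination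
  step.\<close>

lemma realizable_two:
  assumes "\<And>a. ed_le C ({a}, {}) k"
  shows "realizable C (Suc k) 2"
  unfolding realizable_def
proof (intro allI impI)
  fix A :: "nat set" assume A: "infinite A"
  then obtain a where a: "a \<in> A" by (metis finite.emptyI ex_in_conv)
  from A have "infinite (A - {a})" by simp
  then obtain b where b: "b \<in> A" "b \<noteq> a" by (metis Diff_iff finite.emptyI ex_in_conv insertI1)
  let ?G = "({a, b}, {{a, b}}) :: graph"
  have wf: "wf_graph ?G" using b by (auto simp: wf_graph_def verts_def edges_def)
  have "opt_cover ?G {x} \<le> 1" if "x \<in> {a, b}" for x
    using opt_cover_le[of ?G "{x}" "{x}"] that by (auto simp: vertex_cover_def verts_def edges_def)
  moreover have "OPT ?G \<ge> 1"
  proof -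
    obtain X where X: "vertex_cover ?G X" "card X = OPT ?G"
      using opt_cover_attained[OF wf, of "{}"] by (auto simp: OPT_eq_opt_cover)
    have "X \<noteq> {}" using X(1) by (auto simp: vertex_cover_def edges_def)
    then show ?thesis
      using vertex_cover_finite[OF wf X(1)] X(2) by (metis One_nat_def Suc_leI card_gt_0_iff)
  qed
  moreover have "OPT ?G \<le> opt_cover ?G {a}"
    unfolding OPT_eq_opt_cover by (rule opt_cover_mono[OF wf]) (auto simp: verts_def)
  ultimately have opt: "OPT ?G = 1" and le: "opt_cover ?G {a} \<le> 1" "opt_cover ?G {b} \<le> 1" by force+
  have "minimal_blocking_set ?G {a, b}"
  proof (rule minimal_blocking_setI[OF wf])
    show "OPT ?G < opt_cover ?G {a, b}"
      using card_le_opt_cover[OF wf, of "{a, b}"] opt b(2) by (simp add: verts_def)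
    fix y assume "y \<in> {a, b}"
    then have "{a, b} - {y} = {a} \<or> {a, b} - {y} = {b}" using b(2) by auto
    then show "opt_cover ?G ({a, b} - {y}) \<le> OPT ?G" unfolding opt using le by metis
  qed (simp add: verts_def)
  moreover have conn: "connected_graph ?G"
  proof -
    have "reach ?G a b" using b(2) by (intro reach_adj) (simp add: adj_def edges_def)
    then show ?thesis using reach_sym reach_refl by (auto simp: connected_graph_def verts_def)
  qed
  moreover have "ed_le C ?G (Suc k)"
  proof (rule ed_le.conn[OF conn, of b])
    have "del_vertex ?G b = ({a}, {})"
      using b(2) by (auto simp: del_vertex_def induced_def verts_def edges_def)
    then show "ed_le C (del_vertex ?G b) k" using assms by simp
  qed (simp add: verts_def)
  moreover have "verts ?G \<subseteq> A" "card {a, b} = 2" using a b by (auto simp: verts_def)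
  ultimately show "\<exists>G Y. wf_graph G \<and> verts G \<subseteq> A \<and> connected_graph G \<and> ed_le C G (Suc k) \<and>
      minimal_blocking_set G Y \<and> card Y = 2"
    using wf by blast
qed

section \<open>Doubling by a new vertex over two disjoint graphs\<close>

text \<open>The vertex \<open>v\<close> is joined to all of \<open>Y1\<close>, so that it raises the optimum by one, and to a
  single vertex \<open>y\<close> of \<open>Y2\<close>: if \<open>v\<close> is left out of a cover, \<open>y\<close> comes for free.\<close>

lemma glue_minimal_blocking_sets:
  assumes wf: "wf_graph G1" "wf_graph G2" and conn: "connected_graph G1" "connected_graph G2"
    and disj: "verts G1 \<inter> verts G2 = {}" and v: "v \<notin> verts G1" "v \<notin> verts G2"
    and Y1: "minimal_blocking_set G1 Y1" and Y2: "minimal_blocking_set G2 Y2" and y: "y \<in> Y2"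
    and ed: "ed_le C G1 k" "ed_le C G2 k"
  defines "G \<equiv> (insert v (verts G1 \<union> verts G2),
    edges G1 \<union> edges G2 \<union> (\<lambda>u. {u, v}) ` insert y Y1)"
  shows "wf_graph G" "connected_graph G" "ed_le C G (Suc k)"
    "minimal_blocking_set G (Y1 \<union> (Y2 - {y}))"
proof -
  note m1 = minimal_blocking_setD[OF wf(1) Y1] and m2 = minimal_blocking_setD[OF wf(2) Y2]
  let ?V1 = "verts G1" and ?V2 = "verts G2" and ?Y = "Y1 \<union> (Y2 - {y})"
  define H where "H = del_vertex G v"
  have verts_G: "verts G = insert v (?V1 \<union> ?V2)" by (simp add: G_def verts_def)
  have edges_G: "edges G = edges G1 \<union> edges G2 \<union> (\<lambda>u. {u, v}) ` insert y Y1"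
    by (simp add: G_def edges_def)
  have sub1: "e \<subseteq> ?V1 \<and> e \<noteq> {}" if "e \<in> edges G1" for e
    using wf_graph_edge_subset[OF wf(1) that] wf(1) that by (auto elim: wf_graph_edgeE)
  have sub2: "e \<subseteq> ?V2 \<and> e \<noteq> {}" if "e \<in> edges G2" for e
    using wf_graph_edge_subset[OF wf(2) that] wf(2) that by (auto elim: wf_graph_edgeE)
  have NV: "insert y Y1 \<subseteq> ?V1 \<union> ?V2" using m1(1) m2(1) y by blast
  show wfG: "wf_graph G"
    unfolding wf_graph_def
  proof (intro conjI ballI)
    show "finite (verts G)" using wf wf_graph_finite by (simp add: verts_G)
    fix e assume "e \<in> edges G"
    then consider "e \<in> edges G1" | "e \<in> edges G2" | u where "u \<in> insert y Y1" "e = {u, v}"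
      by (auto simp: edges_G)
    then show "\<exists>a b. a \<noteq> b \<and> e = {a, b} \<and> a \<in> verts G \<and> b \<in> verts G"
    proof cases
      case 1
      show ?thesis using wf(1) 1 by (rule wf_graph_edgeE) (auto simp: verts_G)
    next
      case 2
      show ?thesis using wf(2) 2 by (rule wf_graph_edgeE) (auto simp: verts_G)
    next
      case 3
      then show ?thesis using NV v by (intro exI[of _ u] exI[of _ v]) (auto simp: verts_G)
    qed
  qed
  have verts_H: "verts H = ?V1 \<union> ?V2" using v by (auto simp: H_def verts_G)
  have edges_H: "edges H = edges G1 \<union> edges G2"
  proof -
    have "edges H = {e \<in> edges G. e \<subseteq> ?V1 \<union> ?V2}"
      using verts_H by (simp add: H_def del_vertex_def)
    also have "\<dots> = edges G1 \<union> edges G2" using v sub1 sub2 by (auto simp: edges_G)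
    finally show ?thesis .
  qed
  have wfH: "wf_graph H" unfolding H_def using wfG by (rule wf_graph_del_vertex)
  have H1: "induced H ?V1 = G1"
  proof (rule graph_eqI)
    have "\<not> e \<subseteq> ?V1" if "e \<in> edges G2" for e using sub2[OF that] disj by blast
    then show "edges (induced H ?V1) = edges G1" using sub1 by (auto simp: edges_H)
  qed simp
  have H2: "induced H ?V2 = G2"
  proof (rule graph_eqI)
    have "\<not> e \<subseteq> ?V2" if "e \<in> edges G1" for e using sub1[OF that] disj by blast
    then show "edges (induced H ?V2) = edges G2" using sub2 by (auto simp: edges_H)
  qed simp
  have ne: "?V1 \<noteq> {}" "?V2 \<noteq> {}" using conn by (auto simp: connected_graph_def)
  then have ne12: "?V1 \<noteq> ?V2" using disj by auto

  have to_v: "reach G a v" if a: "a \<in> verts G" for a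
  proof -
    have nb: "reach G u v" if "u \<in> insert y Y1" for u
    proof (rule reach_adj)
      have "u \<noteq> v" using that NV v by blast
      then show "adj G u v" using that by (auto simp: adj_def edges_G)
    qed
    obtain y1 where y1: "y1 \<in> Y1" using m1(4) by blast
    consider "a = v" | "a \<in> ?V1" | "a \<in> ?V2" using a unfolding verts_G by blast
    then show ?thesis
    proof cases
      case 1
      then show ?thesis by (simp add: reach_refl)
    next
      case 2
      then have "reach G1 a y1" using conn(1) m1(1) y1 by (auto simp: connected_graph_def)
      then have "reach G a y1" by (rule reach_mono[rotated]) (auto simp: edges_G)
      then show ?thesis using nb[of y1] y1 by (blast intro: reach_trans)
    next
      case 3
      then have "reach G2 a y" using conn(2) m2(1) y by (auto simp: connected_graph_def)
      then have "reach G a y" by (rule reach_mono[rotated]) (auto simp: edges_G)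
      then show ?thesis using nb[of y] by (blast intro: reach_trans)
    qed
  qed
  show connG: "connected_graph G"
    unfolding connected_graph_def
  proof (intro conjI ballI)
    show "verts G \<noteq> {}" by (simp add: verts_G)
  qed (rule reach_trans[OF to_v reach_sym[OF to_v]])

  have closed1: "b \<in> ?V1" if "reach H a b" "a \<in> ?V1" for a b
  proof (rule reach_closed[OF that])
    fix c d assume "adj H c d" "c \<in> ?V1"
    then show "d \<in> ?V1" using sub1[of "{c, d}"] sub2[of "{c, d}"] disj by (auto simp: adj_def edges_H)
  qed
  have closed2: "b \<in> ?V2" if "reach H a b" "a \<in> ?V2" for a b
  proof (rule reach_closed[OF that])
    fix c d assume "adj H c d" "c \<in> ?V2"
    then show "d \<in> ?V2" using sub1[of "{c, d}"] sub2[of "{c, d}"] disj by (auto simp: adj_def edges_H)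
  qed
  have comp: "p = ?V1 \<or> p = ?V2" if "p \<in> component_sets H" for p
  proof -
    obtain a where a: "a \<in> verts H" "p = {w \<in> verts H. reach H a w}"
      using \<open>p \<in> component_sets H\<close> by (auto simp: component_sets_def)
    show ?thesis
    proof (cases "a \<in> ?V1")
      case True
      have "reach H a w" if "w \<in> ?V1" for w
        using conn(1) True that reach_mono[of G1 H a w] by (auto simp: connected_graph_def edges_H)
      then show ?thesis using a closed1 True by (auto simp: verts_H)
    next
      case False
      then have a2: "a \<in> ?V2" using a by (simp add: verts_H)
      have "reach H a w" if "w \<in> ?V2" for w
        using conn(2) a2 that reach_mono[of G2 H a w] by (auto simp: connected_graph_def edges_H)
      then show ?thesis using a closed2 a2 by (auto simp: verts_H)
    qed
  qed
  \<comment> \<open>Without \<open>v\<close> the two nonempty connected graphs are exactly the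
    components, so rule \<open>disconn\<close> adds nothing to \<open>k\<close>.\<close>
  have "ed_le C H k"
  proof (rule ed_le.disconn)
    obtain a b where "a \<in> ?V1" "b \<in> ?V2" using ne by blast
    then show "\<not> connected_graph H"
      using closed1[of a b] disj by (auto simp: connected_graph_def verts_H)
    show "\<forall>K\<in>components H. ed_le C K k" 
      unfolding components_eq using comp ed H1 H2 by (metis imageE)
  qed
  then show "ed_le C G (Suc k)"
    unfolding H_def by (intro ed_le.conn[OF connG]) (auto simp: verts_G)

  have h: "opt_cover H Z = opt_cover G1 (Z \<inter> ?V1) + opt_cover G2 (Z \<inter> ?V2)"
    if "Z \<subseteq> ?V1 \<union> ?V2" for Z
  proof -
    have "opt_cover H Z = (\<Sum>p\<in>{?V1, ?V2}. opt_cover (induced H p) (Z \<inter> p))"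
    proof (rule opt_cover_partition[OF wfH])
      show "pairwise disjnt {?V1, ?V2}" using disj by (auto simp: pairwise_def disjnt_def)
      show "\<exists>p\<in>{?V1, ?V2}. e \<subseteq> p" if "e \<in> edges H" for e
        using that sub1 sub2 by (auto simp: edges_H)
    qed (use that verts_H in auto)
    then show ?thesis using ne12 H1 H2 by simp
  qed
  have nbrs: "nbrs G v = insert y Y1"
    using v sub1 sub2 by (fastforce simp: nbrs_def edges_G doubleton_eq_iff)
  have vG: "v \<in> verts G" by (simp add: verts_G)
  have VG: "verts G - {v} = ?V1 \<union> ?V2" using verts_H by (simp add: H_def)
  have optG: "opt_cover G Z = min (1 + opt_cover H Z) (opt_cover H (insert y Y1 \<union> Z))"
    if "Z \<subseteq> ?V1 \<union> ?V2" for Z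
    using opt_cover_del_vertex[OF wfG vG, of Z] that VG by (simp add: H_def nbrs)
  have y12: "y \<in> ?V2" "y \<notin> ?V1" and Y12: "Y1 \<inter> ?V2 = {}" "Y2 \<inter> ?V1 = {}"
    using y m1(1) m2(1) disj by blast+
  have o1: "opt_cover G1 Y1 = OPT G1 + 1" using wf(1) Y1 by (rule opt_cover_minimal_blocking_set)
  have o2: "opt_cover G2 Y2 = OPT G2 + 1" using wf(2) Y2 by (rule opt_cover_minimal_blocking_set)
  have r1: "opt_cover G1 (Y1 - {z}) = OPT G1" if "z \<in> Y1" for z
    using wf(1) Y1 that by (rule opt_cover_minimal_blocking_set_remove)
  have r2: "opt_cover G2 (Y2 - {z}) = OPT G2" if "z \<in> Y2" for z
    using wf(2) Y2 that by (rule opt_cover_minimal_blocking_set_remove)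
  \<comment> \<open>Taking \<open>v\<close> costs one; omitting it forces all of \<open>Y1\<close>,
    which costs at least one as well.\<close>
  have OPT_G: "OPT G = OPT G1 + OPT G2 + 1"
  proof -
    have "insert y Y1 \<inter> ?V1 = Y1" "insert y Y1 \<inter> ?V2 = {y}" using m1(1) y12 Y12 by auto
    then have "opt_cover H (insert y Y1) = OPT G1 + 1 + opt_cover G2 {y}"
      using h[OF NV] o1 by simp
    moreover have "OPT G2 \<le> opt_cover G2 {y}"
      unfolding OPT_eq_opt_cover using y12 by (intro opt_cover_mono[OF wf(2)]) auto
    moreover have "opt_cover H {} = OPT G1 + OPT G2" using h[of "{}"] by (simp add: OPT_eq_opt_cover)
    ultimately show ?thesis using optG[of "{}"] by (simp add: OPT_eq_opt_cover)
  qed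
  have YV: "?Y \<subseteq> ?V1 \<union> ?V2" using m1(1) m2(1) by blast
  show "minimal_blocking_set G ?Y"
  proof (rule minimal_blocking_setI[OF wfG])
    show "?Y \<subseteq> verts G" using YV verts_G by blast
    \<comment> \<open>With \<open>v\<close> in the cover, \<open>Y1\<close> costs a second extra
      vertex. Without \<open>v\<close>, the neighbour \<open>y\<close> completes \<open>Y2\<close>,
      so both graphs exceed their optimum.\<close>
    have "?Y \<inter> ?V1 = Y1" "?Y \<inter> ?V2 = Y2 - {y}" using m1(1) m2(1) Y12 by auto
    then have "opt_cover H ?Y = OPT G1 + OPT G2 + 1" using h[OF YV] o1 r2[OF y] by simp
    moreover have "(insert y Y1 \<union> ?Y) \<inter> ?V1 = Y1" "(insert y Y1 \<union> ?Y) \<inter> ?V2 = Y2"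
      using m1(1) m2(1) Y12 y y12 by auto
    then have "opt_cover H (insert y Y1 \<union> ?Y) = OPT G1 + OPT G2 + 2"
      using h[of "insert y Y1 \<union> ?Y"] NV YV o1 o2 by simp
    ultimately show "OPT G < opt_cover G ?Y" using optG[OF YV] OPT_G by simp
  next
    fix z assume z: "z \<in> ?Y"
    have YzV: "?Y - {z} \<subseteq> ?V1 \<union> ?V2" using YV by blast
    \<comment> \<open>If \<open>z\<close> is in \<open>Y1\<close>, take \<open>v\<close>: neither
      remaining part blocks. Otherwise omit \<open>v\<close>: the forced \<open>Y1\<close> costs
      one, and \<open>Y2 - {z}\<close>, which now includes \<open>y\<close>, costs nothing
      extra.\<close>
    show "opt_cover G (?Y - {z}) \<le> OPT G"
    proof (cases "z \<in> Y1")
      case True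
      have "(?Y - {z}) \<inter> ?V1 = Y1 - {z}" "(?Y - {z}) \<inter> ?V2 = Y2 - {y}"
        using m1(1) m2(1) Y12 True by auto
      then have "opt_cover H (?Y - {z}) = OPT G1 + OPT G2"
        using h[OF YzV] r1[OF True] r2[OF y] by simp
      then show ?thesis using optG[OF YzV] OPT_G by simp
    next
      case False
      then have z2: "z \<in> Y2" "z \<noteq> y" using z by auto
      let ?W = "insert y Y1 \<union> (?Y - {z})"
      have "?W \<inter> ?V1 = Y1" "?W \<inter> ?V2 = Y2 - {z}"
        using m1(1) m2(1) Y12 y y12 z2 by auto
      then have "opt_cover H ?W = OPT G1 + OPT G2 + 1"
        using h[of ?W] NV YV o1 r2[OF z2(1)] by auto
      then show ?thesis using optG[OF YzV] OPT_G by simp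
    qed
  qed
qed

lemma realizable_double:
  assumes "realizable C k n"
  shows "realizable C (Suc k) (2 * n - 1)"
  unfolding realizable_def
proof (intro allI impI)
  fix A :: "nat set" assume "infinite A"
  then obtain f :: "nat \<Rightarrow> nat" where f: "inj f" "range f \<subseteq> A"
    using infinite_countable_subset by blast
  \<comment> \<open>Odd and positive even indices give two disjoint infinite supplies, and index 0
    is kept for the new vertex.\<close>
  define A1 where "A1 = range (\<lambda>i. f (2 * i + 1))"
  define A2 where "A2 = range (\<lambda>i. f (2 * i + 2))"
  have "infinite A1" "infinite A2" unfolding A1_def A2_def
    by (auto intro!: range_inj_infinite injI simp: inj_eq[OF f(1)])
  then obtain G1 Y1 G2 Y2 where
      G1: "wf_graph G1" "verts G1 \<subseteq> A1" "connected_graph G1" "ed_le C G1 k"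
        "minimal_blocking_set G1 Y1" "card Y1 = n" and
      G2: "wf_graph G2" "verts G2 \<subseteq> A2" "connected_graph G2" "ed_le C G2 k"
        "minimal_blocking_set G2 Y2" "card Y2 = n"
    using assms unfolding realizable_def by metis
  have A: "A1 \<inter> A2 = {}" "f 0 \<notin> A1" "f 0 \<notin> A2"
    by (auto simp: A1_def A2_def inj_eq[OF f(1)]) presburger
  obtain y where y: "y \<in> Y2" using minimal_blocking_setD(4)[OF G2(1,5)] by blast
  have disj: "verts G1 \<inter> verts G2 = {}" and v: "f 0 \<notin> verts G1" "f 0 \<notin> verts G2"
    using A G1(2) G2(2) by blast+
  define G where "G = (insert (f 0) (verts G1 \<union> verts G2),
    edges G1 \<union> edges G2 \<union> (\<lambda>u. {u, f 0}) ` insert y Y1)"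
  note glue = glue_minimal_blocking_sets[OF G1(1) G2(1) G1(3) G2(3) disj v G1(5) G2(5) y G1(4) G2(4),
      folded G_def]
  have Y12: "Y1 \<subseteq> verts G1" "Y2 \<subseteq> verts G2" "finite Y1" "finite Y2"
    using minimal_blocking_setD(1,3)[OF G1(1,5)] minimal_blocking_setD(1,3)[OF G2(1,5)] by auto
  have "card (Y1 \<union> (Y2 - {y})) = card Y1 + card (Y2 - {y})"
    using Y12 disj by (intro card_Un_disjoint) auto
  moreover have "card Y2 > 0" using y Y12(4) by (auto simp: card_gt_0_iff)
  ultimately have "card (Y1 \<union> (Y2 - {y})) = 2 * n - 1"
    using G1(6) G2(6) y by simp
  moreover have "verts G \<subseteq> A"
  proof -
    have "A1 \<subseteq> A" "A2 \<subseteq> A" "f 0 \<in> A" using f(2) by (auto simp: A1_def A2_def)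
    moreover have "verts G = insert (f 0) (verts G1 \<union> verts G2)" by (simp add: G_def verts_def)
    ultimately show ?thesis using G1(2) G2(2) by (metis Un_mono insert_subset order_trans Un_least)
  qed
  ultimately show "\<exists>G Y. wf_graph G \<and> verts G \<subseteq> A \<and> connected_graph G \<and> ed_le C G (Suc k) \<and>
      minimal_blocking_set G Y \<and> card Y = 2 * n - 1"
    using glue by blast
qed

text \<open>Written as \<open>n + 1\<close> because the excess over one is what doubles:
  \<open>2 * (n + 1) - 1 = 2 * n + 1\<close>.\<close>

lemma realizable_iterate:
  assumes "realizable C k (n + 1)"
  shows "realizable C (k + j) (n * 2 ^ j + 1)"
proof (induction j)
  case (Suc j)
  have "2 * (n * 2 ^ j + 1) - 1 = n * 2 ^ Suc j + 1" by simp
  then show ?case using realizable_double[OF Suc.IH] by (metis add_Suc_right)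
qed (use assms in simp)

section \<open>Blocking numbers of graph classes\<close>

lemma finite_minimal_blocking_set_cards:
  assumes "wf_graph G"
  shows "finite {card Y | Y. minimal_blocking_set G Y}"
proof -
  have "{card Y | Y. minimal_blocking_set G Y} \<subseteq> card ` Pow (verts G)"
    using minimal_blocking_setD(1)[OF assms] by auto
  then show ?thesis using wf_graph_finite[OF assms] by (meson finite_Pow_iff finite_imageI finite_subset)
qed

lemma card_le_beta: "wf_graph G \<Longrightarrow> minimal_blocking_set G Y \<Longrightarrow> card Y \<le> beta G"
  unfolding beta_def using finite_minimal_blocking_set_cards by (intro Max_ge) auto

lemma beta_le:
  assumes "wf_graph G" "\<And>Y. minimal_blocking_set G Y \<Longrightarrow> card Y \<le> n"
  shows "beta G \<le> n"
  unfolding beta_def using finite_minimal_blocking_set_cards[OF assms(1)] assms(2) by auto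

lemma beta_attained:
  assumes "wf_graph G" "beta G > 0"
  obtains Y where "minimal_blocking_set G Y" "card Y = beta G"
proof -
  have "beta G \<in> {card Y | Y. minimal_blocking_set G Y} \<union> {0}"
    unfolding beta_def using finite_minimal_blocking_set_cards[OF assms(1)] by (intro Max_in) auto
  then show thesis using assms(2) that by auto
qed

section \<open>Matching the two bounds and evaluating the iteration\<close>

lemma beta_class_d_eqI:
  assumes C: "hereditary C" and b: "\<forall>G\<in>C. \<forall>Y. minimal_blocking_set G Y \<longrightarrow> card Y \<le> b"
    and n: "(blocking_step ^^ d) b = n" and real: "realizable C d n"
  shows "beta_class_d C d = enat n"
proof (rule antisym)
  show "beta_class_d C d \<le> enat n"
    unfolding beta_class_d_def
  proof (rule SUP_least)
    fix G assume "G \<in> {G. wf_graph G \<and> elim_dist C G \<le> d}"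
    then have G: "wf_graph G" "ed_le C G d" using elim_dist_le_iff[of G C d] by auto
    have bnd: "blocking_bounded G ((blocking_step ^^ d) b)"
      using G(2) C G(1) b by (rule ed_le_blocking_bounded)
    have "card Y \<le> n" if "minimal_blocking_set G Y" for Y
      using bnd that n induced_verts[OF G(1)] unfolding blocking_bounded_def
      by (metis order_refl order_trans)
    then show "enat (beta G) \<le> enat n" using beta_le[OF G(1)] by simp
  qed
  obtain G Y where G: "wf_graph G" "ed_le C G d" "minimal_blocking_set G Y" "card Y = n"
    using real infinite_UNIV_nat unfolding realizable_def by metis
  have "enat n \<le> enat (beta G)" using card_le_beta[OF G(1,3)] G(4) by simp
  also have "\<dots> \<le> beta_class_d C d"
    unfolding beta_class_d_def using G(1,2) by (intro SUP_upper) (simp add: elim_dist_le_iff)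
  finally show "enat n \<le> beta_class_d C d" .
qed

text \<open>From 2 on every step is \<open>2 * b - 1\<close>, which doubles the excess over
  one.\<close>

lemma iterate_bound:
  "(blocking_step ^^ d) (Suc (Suc c)) = Suc c * 2 ^ d + 1"
proof (induction d)
  case (Suc d)
  have "1 \<le> 2 ^ d + c * 2 ^ d" by (simp add: trans_le_add1)
  then show ?case using Suc by simp
qed simp

lemma treedepth_blocking:
  "beta_class_d empty_graph_class 1 = 1"
  "beta_class_d empty_graph_class (Suc (Suc d)) = enat (2 ^ d + 1)"
proof -
  have her: "hereditary empty_graph_class"
    using wf_graph_induced by (simp add: hereditary_def empty_graph_class_def)
  have none: "\<forall>G\<in>empty_graph_class. \<forall>Y. minimal_blocking_set G Y \<longrightarrow> card Y \<le> 0"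
    using minimal_blocking_setD(1) unfolding empty_graph_class_def by fastforce
  show "beta_class_d empty_graph_class 1 = 1"
    using beta_class_d_eqI[OF her none, where d = 1 and n = 1] realizable_one[of empty_graph_class 0]
    by (simp add: one_enat_def)
  \<comment> \<open>The empty graph has bound 0, so two steps are spent reaching 2 before doubling
    begins; this is the shift by two in the exponent.\<close>
  have "(blocking_step ^^ Suc (Suc d)) (0::nat) =
      (blocking_step ^^ d) (Suc (Suc 0))"
    by (simp add: funpow_Suc_right del: funpow.simps)
  then have "(blocking_step ^^ Suc (Suc d)) (0::nat) = 2 ^ d + 1"
    using iterate_bound[of d 0] by simp
  moreover have "realizable empty_graph_class (Suc (Suc d)) (2 ^ d + 1)"
    using realizable_iterate[of empty_graph_class 2 1 d]
      realizable_two[OF ed_le_single_vertex, of empty_graph_class 0] by (simp add: numeral_2_eq_2)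
  ultimately show "beta_class_d empty_graph_class (Suc (Suc d)) = enat (2 ^ d + 1)"
    by (rule beta_class_d_eqI[OF her none])
qed

theorem theorem4:
  fixes C :: "graph set" and d :: nat
  assumes "graph_class C" and "hereditary C" and "robust C"
    and "beta_class C \<noteq> \<infinity>"
    and "d \<ge> 1"
  shows "(beta_class C = 1 \<longrightarrow> beta_class_d C d = enat (2 ^ (d - 1) + 1))
       \<and> (beta_class C \<ge> 2 \<longrightarrow>
            beta_class_d C d = (beta_class C - 1) * enat (2 ^ d) + 1)
       \<and> beta_class_d empty_graph_class 1 = 1
       \<and> (d \<ge> 2 \<longrightarrow> beta_class_d empty_graph_class d = enat (2 ^ (d - 2) + 1))"
proof -
  obtain b where b: "beta_class C = enat b" using assms(4) by auto
  have wf: "wf_graph G" if "G \<in> C" for G using assms(1) that by (simp add: graph_class_def)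
  have le: "card Y \<le> b" if "G \<in> C" "minimal_blocking_set G Y" for G Y
  proof -
    have "enat (card Y) \<le> enat (beta G)" using card_le_beta[OF wf[OF that(1)] that(2)] by simp
    also have "\<dots> \<le> enat b" unfolding b[symmetric] beta_class_def using that(1) by (rule SUP_upper)
    finally show ?thesis by simp
  qed
  have bound: "\<forall>G\<in>C. \<forall>Y. minimal_blocking_set G Y \<longrightarrow> card Y \<le> b" using le by blast
  \<comment> \<open>A finite supremum of naturals is attained: some \<open>beta G\<close> exceeds
    \<open>b - 1\<close>. Being positive, it is not the default 0 and so comes from an actual
    set.\<close>
  have attained: "\<exists>G\<in>C. \<exists>Y. minimal_blocking_set G Y \<and> card Y = b" if "b \<ge> 1"
  proof -
    have "enat (b - 1) < beta_class C" using b that by simp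
    then obtain G where G: "G \<in> C" "b - 1 < beta G"
      unfolding beta_class_def by (auto simp: less_SUP_iff)
    then obtain Y where Y: "minimal_blocking_set G Y" "card Y = beta G"
      using beta_attained[OF wf[OF G(1)]] by auto
    then have "card Y = b" using le[OF G(1) Y(1)] G(2) by simp
    then show ?thesis using G(1) Y(1) by blast
  qed
  have "beta_class_d C d = enat (2 ^ (d - 1) + 1)" if "beta_class C = 1"
  proof -
    have b1: "b = 1" using that b by (simp add: one_enat_def)
    then obtain G Y where G: "G \<in> C" "minimal_blocking_set G Y" using attained by auto
    then obtain w where w: "w \<in> verts G" using minimal_blocking_setD(1,4)[OF wf] by blast
    have "induced G {w} \<in> C" using assms(2) G(1) w by (simp add: hereditary_def)
    moreover have "induced G {w} = ({w}, {})"
    proof -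
      have "\<not> e \<subseteq> {w}" if "e \<in> edges G" for e
        using wf[OF G(1)] that by (rule wf_graph_edgeE) auto
      then show ?thesis by (auto simp: induced_def)
    qed
    ultimately have "({w}, {}) \<in> C" by simp
    \<comment> \<open>A constant map is injective on a singleton, so one single-vertex graph in
      \<open>C\<close> yields all of them.\<close>
    then have "map_graph (\<lambda>_. a) ({w}, {}) \<in> C" for a
      using assms(1) by (auto simp: graph_class_def verts_def)
    then have "({a}, {}) \<in> C" for a by (simp add: map_graph_def verts_def edges_def)
    \<comment> \<open>Doubling would keep 1 at \<open>2 * 1 - 1 = 1\<close>, so the first
      elimination step is spent on an edge, which leaves \<open>d - 1\<close> doublings.\<close>
    then have "realizable C (Suc 0) (1 + 1)"
      unfolding one_add_one by (intro realizable_two) (rule ed_le.in_class)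
    then have "realizable C d (2 ^ (d - 1) + 1)"
      using realizable_iterate[of C "Suc 0" 1 "d - 1"] assms(5) by simp
    moreover have iter: "(blocking_step ^^ d) b = 2 ^ (d - 1) + 1"
    proof -
      have "(blocking_step ^^ Suc (d - 1)) (1::nat) =
          (blocking_step ^^ (d - 1)) (Suc (Suc 0))"
        by (simp add: funpow_Suc_right del: funpow.simps)
      then show ?thesis using iterate_bound[of "d - 1" 0] b1 assms(5) by simp
    qed
    ultimately show ?thesis by (intro beta_class_d_eqI[OF assms(2) bound iter])
  qed
  moreover have "beta_class_d C d = (beta_class C - 1) * enat (2 ^ d) + 1" if "beta_class C \<ge> 2"
  proof -
    have "b \<ge> 2" using that b by (simp add: numeral_eq_enat)
    then obtain c where c: "b = Suc (Suc c)" by (metis add_2_eq_Suc le_Suc_ex)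
    then obtain G Y where G: "G \<in> C" "minimal_blocking_set G Y" "card Y = b" using attained by auto
    have "realizable C 0 (Suc c + 1)" using realizable_in_class[OF assms(1,2) G(1,2)] G(3) c by simp
    then have "realizable C d (Suc c * 2 ^ d + 1)"
      using realizable_iterate[of C 0 "Suc c" d] by simp
    then have "beta_class_d C d = enat (Suc c * 2 ^ d + 1)"
      using beta_class_d_eqI[OF assms(2) bound] iterate_bound[of d c] c by simp
    moreover have "beta_class C - 1 = enat (Suc c)" using b c by (simp add: one_enat_def)
    ultimately show ?thesis by (simp add: one_enat_def)
  qed
  moreover have "beta_class_d empty_graph_class d = enat (2 ^ (d - 2) + 1)" if d2: "d \<ge> 2"
  proof -
    obtain d' where "d = Suc (Suc d')" using d2 by (metis add_2_eq_Suc le_Suc_ex)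
    then show ?thesis using treedepth_blocking(2)[of d'] by simp
  qed
  ultimately show ?thesis using treedepth_blocking(1) by blast
qed

end
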